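(* Let $m,n\in\mathbb{N}$ and let $a,b$ be integers with $0\le a\le n$ and $0\le b\le m$. Let $\mathcal{Z}=V_{a,b}$ be the zero-set defined by $\mathbb{Z}_+^2\setminus V_{a,b}=\{(x,y)\in\mathbb{Z}_+^2\colon x\ge a,\ y\ge b\}$. Then $\gamma(\mathcal{Z},m,n)=\max(am,bn)$.
   Context: $\mathbb{Z}_+=\{0,1,2,\dots\}$, $\mathbb{N}=\{1,2,\dots\}$, $[0,c]=\{0,1,\dots,c\}$, and $R_{a,b}=[0,a-1]\times[0,b-1]$. A zero-set (Young diagram) is a downward-closed set $\mathcal{Z}\subseteq\mathbb{Z}_+^2$ (if $(x,y)\in\mathcal{Z}$, $0\le x'\le x$, $0\le y'\le y$, then $(x',y')\in\mathcal{Z}$); $\emptyset$ and infinite sets are allowed. For $m,n\in\mathbb{N}$, the graph $K_m\Box K_n$ is represented on the vertex set $R_{n,m}=[0,n-1]\times[0,m-1]$, with two vertices adjacent iff they differ in exactly one coordinate. For $v=(j,i)\in R_{n,m}$, the row neighborhood $\mathcal{N}^r(v)$ is the set of all $(j',i)\in R_{n,m}$ with $j'\neq j$, and the column neighborhood $\mathcal{N}^c(v)$ is the set of all $(j,i')\in R_{n,m}$ with $i'\ne i$. Given $\mathcal{Z}$, for $A\subseteq R_{n,m}$ let $\mathcal{T}(A)=A\cup\{v\in R_{n,m}\setminus A\colon (|\mathcal{N}^r(v)\cap A|,|\mathcal{N}^c(v)\cap A|)\notin\mathcal{Z}\}$. Then $\gamma(\mathcal{Z},m,n)=\min\{|A|\colon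 A\subseteq R_{n,m},\ \mathcal{T}(A)=R_{n,m}\}$. *)

theory Defs
  imports Main
begin

text \<open>Lattice points are pairs of natural numbers \<open>(x, y)\<close>, with the horizontal coordinate first.\<close>

definition zero_set :: "(nat \<times> nat) set \<Rightarrow> bool" where
  "zero_set Z \<longleftrightarrow> (\<forall>x y x' y'. (x, y) \<in> Z \<longrightarrow> x' \<le> x \<longrightarrow> y' \<le> y \<longrightarrow> (x', y') \<in> Z)"

definition rect :: "nat \<Rightarrow> nat \<Rightarrow> (nat \<times> nat) set" where
  "rect a b = {..<a} \<times> {..<b}"

text \<open>
  The graph \<open>K\<^sub>m \<box> K\<^sub>n\<close> has vertex set \<open>rect n m\<close> (note the order of the arguments):
  it has \<open>m\<close> rows, each of which is a copy of \<open>K\<^sub>n\<close>. All functions below take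
  \<open>m\<close> before \<open>n\<close>.
\<close>

definition row_nbhd :: "nat \<Rightarrow> nat \<Rightarrow> nat \<times> nat \<Rightarrow> (nat \<times> nat) set" where
  "row_nbhd m n v = {(j', i'). (j', i') \<in> rect n m \<and> i' = snd v \<and> j' \<noteq> fst v}"

definition col_nbhd :: "nat \<Rightarrow> nat \<Rightarrow> nat \<times> nat \<Rightarrow> (nat \<times> nat) set" where
  "col_nbhd m n v = {(j', i'). (j', i') \<in> rect n m \<and> j' = fst v \<and> i' \<noteq> snd v}"

definition growth_step ::
    "(nat \<times> nat) set \<Rightarrow> nat \<Rightarrow> nat \<Rightarrow> (nat \<times> nat) set \<Rightarrow> (nat \<times> nat) set" where
  "growth_step Z m n A =
     A \<union> {v \<in> rect n m - A. (card (row_nbhd m n v \<inter> A), card (col_nbhd m n v \<inter> A)) \<notin> Z}"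

text \<open>
  The minimum below is over a finite nonempty set, by the lemma \<open>gamma_set_finite_nonempty\<close>.
\<close>

definition gamma :: "(nat \<times> nat) set \<Rightarrow> nat \<Rightarrow> nat \<Rightarrow> nat" where
  "gamma Z m n = Min {card A | A. A \<subseteq> rect n m \<and> growth_step Z m n A = rect n m}"

definition V :: "nat \<Rightarrow> nat \<Rightarrow> (nat \<times> nat) set" where
  "V a b = - {(x, y). x \<ge> a \<and> y \<ge> b}"

lemma zero_set_V: "zero_set (V a b)"
  by (auto simp: zero_set_def V_def)

lemma gamma_set_finite_nonempty:
  "finite {card A | A. A \<subseteq> rect n m \<and> growth_step Z m n A = rect n m}"
  "{card A | A. A \<subseteq> rect n m \<and> growth_step Z m n A = rect n m} \<noteq> {}"
proof -
  have "finite (card ` Pow (rect n m))"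
    by (simp add: rect_def)
  then show "finite {card A | A. A \<subseteq> rect n m \<and> growth_step Z m n A = rect n m}"
    by (rule rev_finite_subset) auto
  have "growth_step Z m n (rect n m) = rect n m"
    by (auto simp: growth_step_def)
  then show "{card A | A. A \<subseteq> rect n m \<and> growth_step Z m n A = rect n m} \<noteq> {}"
    by blast
qed

end

theory Submission
  imports Defs
begin

text \<open>
  A set \<open>A\<close> fills the rectangle in one step iff every row meets \<open>A\<close> in at least \<open>a\<close> points and
  every column in at least \<open>b\<close> points: a full row or column satisfies this because \<open>a \<le> n\<close> and
  \<open>b \<le> m\<close>. Counting by rows and by columns gives the lower bound. If \<open>b n \<le> a m\<close>, the bound is
  attained by filling the rows with \<open>a\<close> points each while running cyclically through the columns,
  \<open>A = {(t mod n, t div a) | t < a m}\<close>; the other case follows by transposition.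
\<close>

lemma finite_slices:
  assumes "A \<subseteq> rect n m"
  shows "finite {j. (j, i) \<in> A}" "finite {i. (j, i) \<in> A}"
proof -
  have "{j. (j, i) \<in> A} \<subseteq> {..<n}" "{i. (j, i) \<in> A} \<subseteq> {..<m}"
    using assms by (auto simp: rect_def)
  then show "finite {j. (j, i) \<in> A}" "finite {i. (j, i) \<in> A}"
    by (auto intro: finite_subset)
qed

text \<open>The neighborhood omits the vertex itself; since the vertex lies outside
  \<open>A\<close>, nothing is lost and the count depends on the row alone. This turns a condition
  on vertices into one on rows.\<close>

lemma card_row_nbhd_Int:
  assumes "A \<subseteq> rect n m" "(j, i) \<notin> A"
  shows "card (row_nbhd m n (j, i) \<inter> A) = card {j'. (j', i) \<in> A}"
proof -
  have "row_nbhd m n (j, i) \<inter> A = (\<lambda>j'. (j', i)) ` {j'. (j', i) \<in> A}"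
    using assms by (auto simp: row_nbhd_def)
  then show ?thesis
    by (simp add: card_image inj_on_def)
qed

lemma card_col_nbhd_Int:
  assumes "A \<subseteq> rect n m" "(j, i) \<notin> A"
  shows "card (col_nbhd m n (j, i) \<inter> A) = card {i'. (j, i') \<in> A}"
proof -
  have "col_nbhd m n (j, i) \<inter> A = (\<lambda>i'. (j, i')) ` {i'. (j, i') \<in> A}"
    using assms by (auto simp: col_nbhd_def)
  then show ?thesis
    by (simp add: card_image inj_on_def)
qed

lemma growth_step_V_eq_rect_iff:
  assumes A: "A \<subseteq> rect n m" and "a \<le> n" "b \<le> m"
  shows "growth_step (V a b) m n A = rect n m \<longleftrightarrow>
    (\<forall>i<m. a \<le> card {j. (j, i) \<in> A}) \<and> (\<forall>j<n. b \<le> card {i. (j, i) \<in> A})"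
    (is "_ \<longleftrightarrow> ?rows \<and> ?cols")
proof -
  have "growth_step (V a b) m n A = rect n m \<longleftrightarrow>
      (\<forall>v \<in> rect n m - A. (card (row_nbhd m n v \<inter> A), card (col_nbhd m n v \<inter> A)) \<notin> V a b)"
    using A by (auto simp: growth_step_def)
  also have "\<dots> \<longleftrightarrow> (\<forall>(j, i) \<in> rect n m - A.
      a \<le> card {j'. (j', i) \<in> A} \<and> b \<le> card {i'. (j, i') \<in> A})"
    by (rule ball_cong) (auto simp: V_def card_row_nbhd_Int[OF A] card_col_nbhd_Int[OF A])
  also have "\<dots> \<longleftrightarrow> ?rows \<and> ?cols"
  proof
    assume *: "\<forall>(j, i) \<in> rect n m - A.
      a \<le> card {j'. (j', i) \<in> A} \<and> b \<le> card {i'. (j, i') \<in> A}"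
    have "a \<le> card {j. (j, i) \<in> A}" if "i < m" for i
    proof (cases "{..<n} \<subseteq> {j. (j, i) \<in> A}")
      case True
      from card_mono[OF finite_slices(1)[OF A] this] show ?thesis
        using \<open>a \<le> n\<close> by simp
    next
      case False
      then show ?thesis
        using * that by (auto simp: rect_def)
    qed
    moreover have "b \<le> card {i. (j, i) \<in> A}" if "j < n" for j
    proof (cases "{..<m} \<subseteq> {i. (j, i) \<in> A}")
      case True
      from card_mono[OF finite_slices(2)[OF A] this] show ?thesis
        using \<open>b \<le> m\<close> by simp
    next
      case False
      then show ?thesis
        using * that by (auto simp: rect_def)
    qed
    ultimately show "?rows \<and> ?cols"
      by blast
  qed (auto simp: rect_def)
  finally show ?thesis .
qed

lemma card_eq_sum_cols:
  assumes "A \<subseteq> rect n m"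
  shows "card A = (\<Sum>j<n. card {i. (j, i) \<in> A})"
proof -
  have "A = Sigma {..<n} (\<lambda>j. {i. (j, i) \<in> A})"
    using assms by (auto simp: rect_def)
  then have "card A = card (Sigma {..<n} (\<lambda>j. {i. (j, i) \<in> A}))"
    by (rule arg_cong)
  then show ?thesis
    by (simp add: finite_slices[OF assms])
qed

lemma card_eq_sum_rows:
  assumes "A \<subseteq> rect n m"
  shows "card A = (\<Sum>i<m. card {j. (j, i) \<in> A})"
proof -
  have "prod.swap ` A \<subseteq> rect m n"
    using assms by (auto simp: rect_def)
  from card_eq_sum_cols[OF this] show ?thesis
    by (simp add: card_image pair_in_swap_image)
qed

text \<open>Equal quotients put \<open>s\<close> and \<open>t\<close> in one block of
  \<open>a\<close> consecutive integers, so they differ by less than \<open>a\<close> \<le>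
  \<open>n\<close>, while equal residues make the difference a multiple of \<open>n\<close>. This is
  the injectivity of the cyclic filling.\<close>

lemma div_mod_eq_imp_eq:
  fixes s t :: nat
  assumes "a \<le> n" "0 < a" "s mod n = t mod n" "s div a = t div a"
  shows "s = t"
proof -
  \<comment> \<open>Ordering the two numbers keeps the truncated difference \<open>t - s\<close>
    faithful; the other order follows by symmetry.\<close>
  have "s = t" if "s \<le> t" "s mod n = t mod n" "s div a = t div a" for s t
  proof -
    have "t - s < a"
      using mod_less_divisor[OF \<open>0 < a\<close>, of t]
        div_mult_mod_eq[of t a] div_mult_mod_eq[of s a, unfolded that(3)] by linarith
    moreover have "n dvd t - s"
      using that(1,2) by (metis mod_eq_dvd_iff_nat)
    ultimately show "s = t"
      using \<open>a \<le> n\<close> that(1) by (auto dest!: dvd_imp_le)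
  qed
  from this[of s t] this[of t s] show ?thesis
    using assms by linarith
qed

lemma cyclic_filling_exists:
  assumes "a \<le> n" and "b * n \<le> a * m"
  obtains A where "A \<subseteq> rect n m" "card A = a * m"
    "\<forall>i<m. a \<le> card {j. (j, i) \<in> A}" "\<forall>j<n. b \<le> card {i. (j, i) \<in> A}"
proof (cases "a = 0")
  \<comment> \<open>Division by \<open>a\<close> would be degenerate here. The assumption forces
    \<open>b * n\<close> = 0, so \<open>b\<close> = 0 or there are no columns, and the empty set
    suffices.\<close>
  case True
  then show ?thesis
    using assms that[of "{}"] by auto
next
  case False
  define f where "f = (\<lambda>t. (t mod n, t div a))"
  define A where "A = f ` {..<a * m}"
  have "inj f"
    using False div_mod_eq_imp_eq[OF \<open>a \<le> n\<close>] by (auto simp: inj_def f_def)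
  have "A \<subseteq> rect n m"
    using False \<open>a \<le> n\<close> by (auto simp: A_def f_def rect_def less_mult_imp_div_less mult.commute)
  moreover have "card A = a * m"
    using \<open>inj f\<close> by (simp add: A_def card_image inj_on_subset)
  moreover have "a \<le> card {j. (j, i) \<in> A}" if "i < m" for i
  proof -
    \<comment> \<open>Row \<open>i\<close> receives exactly the block of times from
      \<open>i * a\<close> to \<open>i * a + a - 1\<close>. Since the row is fixed on this block,
      injectivity of \<open>f\<close> forces distinct columns.\<close>
    let ?g = "\<lambda>k. (i * a + k) mod n"
    have f: "f (i * a + k) = (?g k, i)" if "k < a" for k
      using that by (simp add: f_def)
    have "inj_on ?g {..<a}"
      using f \<open>inj f\<close> by (intro inj_onI) (metis add_left_cancel injD lessThan_iff)
    moreover have "?g ` {..<a} \<subseteq> {j. (j, i) \<in> A}"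
    proof clarsimp
      fix k assume "k < a"
      have "i * a + k < Suc i * a" using \<open>k < a\<close> by simp
      also have "\<dots> \<le> a * m" using \<open>i < m\<close> by (metis Suc_leI mult.commute mult_le_mono1)
      finally show "(?g k, i) \<in> A"
        using f[OF \<open>k < a\<close>] unfolding A_def by (metis image_eqI lessThan_iff)
    qed
    ultimately show ?thesis
      using card_inj_on_le[OF _ _ finite_slices(1)[OF \<open>A \<subseteq> rect n m\<close>]] by fastforce
  qed
  moreover have "b \<le> card {i. (j, i) \<in> A}" if "j < n" for j
  proof -
    \<comment> \<open>Column \<open>j\<close> is visited at the times \<open>j\<close>,
      \<open>j + n\<close>, \<open>j + 2 * n\<close> and so on. The first \<open>b\<close> of them
      precede \<open>b * n\<close> \<le> \<open>a * m\<close>, and injectivity of \<open>f\<close>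
      forces distinct rows.\<close>
    let ?g = "\<lambda>k. (j + k * n) div a"
    have f: "f (j + k * n) = (j, ?g k)" for k
      using that by (simp add: f_def)
    have "inj ?g"
      using f \<open>inj f\<close> \<open>j < n\<close> by (intro injI) (metis add_left_cancel injD mult_cancel2 not_less0)
    then have "inj_on ?g {..<b}"
      by (rule inj_on_subset) simp
    moreover have "?g ` {..<b} \<subseteq> {i. (j, i) \<in> A}"
    proof clarsimp
      fix k assume "k < b"
      have "j + k * n < Suc k * n" using \<open>j < n\<close> by simp
      also have "\<dots> \<le> b * n" using \<open>k < b\<close> by (metis Suc_leI mult_le_mono1)
      finally have "j + k * n < a * m" using assms(2) by simp
      then show "(j, ?g k) \<in> A"
        using f[of k] unfolding A_def by (metis image_eqI lessThan_iff)
    qed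
    ultimately show ?thesis
      using card_inj_on_le[OF _ _ finite_slices(2)[OF \<open>A \<subseteq> rect n m\<close>]] by fastforce
  qed
  ultimately show ?thesis
    using that by blast
qed

lemma optimal_filling_exists:
  assumes "a \<le> n" "b \<le> m"
  obtains A where "A \<subseteq> rect n m" "card A = max (a * m) (b * n)"
    "\<forall>i<m. a \<le> card {j. (j, i) \<in> A}" "\<forall>j<n. b \<le> card {i. (j, i) \<in> A}"
proof (cases "b * n \<le> a * m")
  case True
  with cyclic_filling_exists[OF \<open>a \<le> n\<close> True] that show ?thesis
    by (metis max.absorb1)
next
  case False
  then have "a * m \<le> b * n" by simp
  \<comment> \<open>The construction is applied to the transposed rectangle, with \<open>a\<close>,
    \<open>b\<close> and \<open>m\<close>, \<open>n\<close> exchanged; reflecting \<open>B\<close>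
    in the diagonal swaps the row and column bounds back.\<close>
  from cyclic_filling_exists[OF \<open>b \<le> m\<close> this] obtain B where
    B: "B \<subseteq> rect m n" "card B = b * n"
      "\<forall>j<n. b \<le> card {i. (i, j) \<in> B}" "\<forall>i<m. a \<le> card {j. (i, j) \<in> B}" .
  have "prod.swap ` B \<subseteq> rect n m"
    using B(1) by (auto simp: rect_def)
  with B \<open>a * m \<le> b * n\<close> show ?thesis
    by (intro that[of "prod.swap ` B"]) (simp_all add: card_image pair_in_swap_image)
qed

theorem proposition1p1:
  fixes m n a b :: nat
  assumes "m \<ge> 1" and "n \<ge> 1"
    and "a \<le> n" and "b \<le> m"
  shows "gamma (V a b) m n = max (a * m) (b * n)"
  unfolding gamma_def
proof (rule Min_eqI[OF gamma_set_finite_nonempty(1)])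
  fix k
  assume "k \<in> {card A |A. A \<subseteq> rect n m \<and> growth_step (V a b) m n A = rect n m}"
  then obtain A where A: "A \<subseteq> rect n m" "k = card A"
    and *: "\<forall>i<m. a \<le> card {j. (j, i) \<in> A}" "\<forall>j<n. b \<le> card {i. (j, i) \<in> A}"
    using growth_step_V_eq_rect_iff \<open>a \<le> n\<close> \<open>b \<le> m\<close> by auto
  have "m * a \<le> card A"
    unfolding card_eq_sum_rows[OF A(1)]
    using sum_bounded_below[of "{..<m}" a "\<lambda>i. card {j. (j, i) \<in> A}"] * by simp
  moreover have "n * b \<le> card A"
    unfolding card_eq_sum_cols[OF A(1)]
    using sum_bounded_below[of "{..<n}" b "\<lambda>j. card {i. (j, i) \<in> A}"] * by simp
  ultimately show "max (a * m) (b * n) \<le> k"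
    using A(2) by (simp add: mult.commute)
next
  show "max (a * m) (b * n) \<in> {card A |A. A \<subseteq> rect n m \<and> growth_step (V a b) m n A = rect n m}"
    using optimal_filling_exists[OF \<open>a \<le> n\<close> \<open>b \<le> m\<close>]
      growth_step_V_eq_rect_iff[OF _ \<open>a \<le> n\<close> \<open>b \<le> m\<close>]
    by (smt (verit) mem_Collect_eq)
qed

end
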